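(* Let $x_0 \in (0,\infty)$ and $\alpha \in (0,1)$, let $\beta \in (0,1)$ and $c \in (0,\frac12]$, and let $f : \mathbb{R}^{2\times 2} \to \mathbb{R}$ be defined by $$f(X) := \frac{X_{1,1}^2 + (X_{2,2}-1)^2 + (X_{1,2}-X_{2,1})^2}{2}.$$ Consider the minimization of $f$ on $\mathbb{R}^{2\times 2}_{\le 1}$. Starting from $X_0 := \operatorname{diag}(x_0,0)$ and using $\bar\alpha := \underline{\alpha} := \alpha$, $\beta$ and $c$, the algorithm $\mathrm{P}^2\mathrm{GD}$ produces the sequence $(X_i)_{i\in\mathbb{N}}$ defined by $$X_i := \operatorname{diag}((1-\alpha)^i x_0, 0) \quad \text{for every } i \in \mathbb{N}.$$ Moreover, $\mathrm{s}_f(X_i) = (1-\alpha)^i x_0$ for every $i \in \mathbb{N}$. In particular, since $\mathrm{s}_f(0_{2\times 2}) = \|\nabla f(0_{2\times 2})\| = 1$, the triplet $(0_{2\times 2}, (X_i)_{i\in\mathbb{N}}, f)$ is an apocalypse.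
   Context: $\mathbb{N}$ includes $0$. $\mathbb{R}^{2\times 2}$ carries the Frobenius inner product and $\|\cdot\|$ is the Frobenius norm; gradients are taken with respect to this inner product. $\mathbb{R}^{2\times 2}_{\le 1} := \{X \in \mathbb{R}^{2\times 2} \mid \operatorname{rank} X \le 1\}$. For a nonempty set $\mathcal{S} \subseteq \mathbb{R}^{2\times 2}$ and $X \in \mathbb{R}^{2\times 2}$, $P_{\mathcal{S}}(X) := \operatorname{argmin}_{Y\in\mathcal{S}} \|X-Y\|$ (a set, identified with its element when it is a singleton). For $X \in \mathcal{S}$, the tangent cone $T_{\mathcal{S}}(X)$ is the set of all $V \in \mathbb{R}^{2\times 2}$ for which there exist $(t_i)_{i\in\mathbb{N}}$ in $(0,\infty)$ converging to $0$ and $(V_i)_{i\in\mathbb{N}}$ in $\mathbb{R}^{2\times 2}$ converging to $V$ such that $X+t_iV_i \in \mathcal{S}$ for every $i$; it is a closed cone, and for a closed cone $\mathcal{C}$ all elements of $P_{\mathcal{C}}(X)$ have the same norm. Stationarity measure: for $X \in \mathbb{R}^{2\times 2}_{\le 1}$, $\mathrm{s}_f(X) := \|P_{T_{\mathbb{R}^{2\times 2}_{\le 1}}(X)}(-\nabla f(X))\|$ (norm of any element of this projection). Apocalypse: a triplet $(X,(X_i)_{i\in\mathbb{N}},f)$ such that $(X_i)_{i\in\mathbb{N}}$ is a sequence in $\mathbb{R}^{2\times 2}_{\le 1}$ converging to $X \in \mathbb{R}^{2\times 2}_{\le 1}$ with $\lim_{i\to\infty} \mathrm{s}_f(X_i)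 = 0 < \mathrm{s}_f(X)$. $\mathrm{P}^2\mathrm{GD}$ map with parameters $0 < \underline{\alpha} \le \bar\alpha < \infty$, $\beta, c \in (0,1)$: given $X \in \mathbb{R}^{2\times 2}_{\le 1}$ with $\mathrm{s}_f(X) > 0$, choose $G \in P_{T_{\mathbb{R}^{2\times 2}_{\le 1}}(X)}(-\nabla f(X))$, a step size $\alpha \in [\underline{\alpha},\bar\alpha]$, and $Y \in P_{\mathbb{R}^{2\times 2}_{\le 1}}(X+\alpha G)$; while $f(Y) > f(X) - c\,\alpha\,\mathrm{s}_f(X)^2$, replace $\alpha$ by $\alpha\beta$ and choose a new $Y \in P_{\mathbb{R}^{2\times 2}_{\le 1}}(X+\alpha G)$; then return $Y$. The set of all possible outputs is $\mathrm{P}^2\mathrm{GD}(X; f,\underline{\alpha},\bar\alpha,\beta,c)$. The algorithm $\mathrm{P}^2\mathrm{GD}$ (with stopping tolerance $0$): starting from $X_0 \in \mathbb{R}^{2\times 2}_{\le 1}$, as long as $\mathrm{s}_f(X_i) > 0$, choose $X_{i+1} \in \mathrm{P}^2\mathrm{GD}(X_i; f,\underline{\alpha},\bar\alpha,\beta,c)$. "Produces the sequence $(X_i)$" means that the algorithm never stops and that its iterates are the $X_i$. *)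

theory Defs
  imports "HOL-Analysis.Analysis"
begin

text \<open>
  On \<^typ>\<open>real^2^2\<close> the library's \<open>\<bullet>\<close> and \<^const>\<open>norm\<close> are the Frobenius inner
  product and the Frobenius norm. The matrix \<open>A\<close> has entries \<open>A$i$j\<close> (row \<open>i\<close>, column \<open>j\<close>).
\<close>

definition rank_le_1 :: "(real^2^2) set" where
  "rank_le_1 = {X. rank X \<le> 1}"

definition diag2 :: "real \<Rightarrow> real \<Rightarrow> real^2^2" where
  "diag2 a b = vector [vector [a, 0], vector [0, b]]"

text \<open>The gradient is unique when it exists, so \<open>THE\<close> is meaningful at points of differentiability.\<close>

definition grad :: "('a::real_inner \<Rightarrow> real) \<Rightarrow> 'a \<Rightarrow> 'a" where
  "grad f X = (THE G. GDERIV f X :> G)"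

definition proj :: "'a::real_normed_vector set \<Rightarrow> 'a \<Rightarrow> 'a set" where
  "proj S X = {Y. is_arg_min (\<lambda>Y. norm (X - Y)) (\<lambda>Y. Y \<in> S) Y}"

definition tangent_cone :: "'a::real_normed_vector set \<Rightarrow> 'a \<Rightarrow> 'a set" where
  "tangent_cone S X =
     {V. \<exists>t Vs. (\<forall>i::nat. 0 < t i) \<and> t \<longlonglongrightarrow> (0::real) \<and> Vs \<longlonglongrightarrow> V \<and>
            (\<forall>i. X + t i *\<^sub>R Vs i \<in> S)}"

text \<open>
  All elements of the projection onto a closed cone have the same norm; \<^const>\<open>the_elem\<close>
  picks that common value.
\<close>

definition stationarity :: "(real^2^2 \<Rightarrow> real) \<Rightarrow> real^2^2 \<Rightarrow> real" where
  "stationarity f X = the_elem (norm ` proj (tangent_cone rank_le_1 X) (- grad f X))"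

definition apocalypse :: "real^2^2 \<Rightarrow> (nat \<Rightarrow> real^2^2) \<Rightarrow> (real^2^2 \<Rightarrow> real) \<Rightarrow> bool" where
  "apocalypse X Xs f \<longleftrightarrow>
     X \<in> rank_le_1 \<and> (\<forall>i. Xs i \<in> rank_le_1) \<and> Xs \<longlonglongrightarrow> X \<and>
     (\<lambda>i. stationarity f (Xs i)) \<longlonglongrightarrow> 0 \<and> 0 < stationarity f X"

text \<open>
  \<open>p2gd_search f \<beta> c X G a Y\<close>: the backtracking loop at \<open>X\<close> along \<open>G\<close>, entered with step size
  \<open>a\<close>, can return \<open>Y\<close>. Every element of a projection is a possible choice.
\<close>

inductive p2gd_search ::
  "(real^2^2 \<Rightarrow> real) \<Rightarrow> real \<Rightarrow> real \<Rightarrow> real^2^2 \<Rightarrow> real^2^2 \<Rightarrow> real \<Rightarrow> real^2^2 \<Rightarrow> bool"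
  for f :: "real^2^2 \<Rightarrow> real" and \<beta> c :: real and X G :: "real^2^2"
where
  accept: "Y \<in> proj rank_le_1 (X + a *\<^sub>R G) \<Longrightarrow>
    \<not> f Y > f X - c * a * (stationarity f X)\<^sup>2 \<Longrightarrow>
    p2gd_search f \<beta> c X G a Y"
| backtrack: "Z \<in> proj rank_le_1 (X + a *\<^sub>R G) \<Longrightarrow>
    f Z > f X - c * a * (stationarity f X)\<^sup>2 \<Longrightarrow>
    p2gd_search f \<beta> c X G (a * \<beta>) Y \<Longrightarrow>
    p2gd_search f \<beta> c X G a Y"

text \<open>The set of all possible outputs; \<open>al\<close> and \<open>au\<close> bound the initial step size.\<close>

definition p2gd_map ::
  "(real^2^2 \<Rightarrow> real) \<Rightarrow> real \<Rightarrow> real \<Rightarrow> real \<Rightarrow> real \<Rightarrow> real^2^2 \<Rightarrow> (real^2^2) set" where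
  "p2gd_map f al au \<beta> c X =
     {Y. \<exists>G \<in> proj (tangent_cone rank_le_1 X) (- grad f X). \<exists>a \<in> {al..au}.
           p2gd_search f \<beta> c X G a Y}"

text \<open>
  The algorithm is nondeterministic. It produces \<open>Xs\<close> if it never stops and, whatever
  choices are made, its iterates are the \<open>Xs i\<close>; hence a set equality rather than membership.
\<close>

definition p2gd_produces ::
  "(real^2^2 \<Rightarrow> real) \<Rightarrow> real \<Rightarrow> real \<Rightarrow> real \<Rightarrow> real \<Rightarrow> real^2^2 \<Rightarrow> (nat \<Rightarrow> real^2^2) \<Rightarrow> bool" where
  "p2gd_produces f al au \<beta> c X0 Xs \<longleftrightarrow>
     X0 \<in> rank_le_1 \<and> Xs 0 = X0 \<and>
     (\<forall>i. 0 < stationarity f (Xs i) \<and> p2gd_map f al au \<beta> c (Xs i) = {Xs (Suc i)})"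

end

theory Submission
  imports Defs
begin

text \<open>
  At \<open>diag(x, 0)\<close> with \<open>x > 0\<close> the tangent cone contains only matrices \<open>V\<close> with \<open>V$2$2 = 0\<close>, so
  projecting \<open>- grad f = diag(-x, 1)\<close> discards the entry \<open>1\<close> and leaves \<open>diag(-x, 0)\<close>. The first
  trial point \<open>diag((1 - \<alpha>) x, 0)\<close> already has rank at most 1, and it is accepted because the
  decrease of \<open>f\<close> exceeds the required one by \<open>\<alpha> x\<^sup>2 (1 - \<alpha>/2 - c) \<ge> 0\<close>. At \<open>0\<close>, where the
  tangent cone is larger, \<open>diag(0, 1)\<close> is tangent and the discarded entry reappears.
\<close>

text \<open>As a 2x2 rank never exceeds 2, failing to be injective is the same as lying in
  \<open>rank_le_1\<close>. The polynomial form is what survives passing to limits.\<close>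

lemma rank_le_1_iff_det: "A \<in> rank_le_1 \<longleftrightarrow> A$1$1 * A$2$2 - A$1$2 * A$2$1 = 0"
proof -
  have "rank A \<le> 2"
    using rank_bound[of A] by simp
  hence "A \<in> rank_le_1 \<longleftrightarrow> rank A \<noteq> CARD(2)"
    by (auto simp: rank_le_1_def)
  also have "\<dots> \<longleftrightarrow> det A = 0"
    by (metis det_nz_iff_inj full_rank_injective matrix_of_matrix_vector_mul matrix_vector_mul_linear)
  finally show ?thesis
    by (simp add: det_2)
qed

lemma diag2_nth [simp]:
  "diag2 a b $ 1 $ 1 = a" "diag2 a b $ 1 $ 2 = 0"
  "diag2 a b $ 2 $ 1 = 0" "diag2 a b $ 2 $ 2 = b"
  by (simp_all add: diag2_def)

lemma matrix_2_eq_iff: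
  fixes A B :: "'a^2^2"
  shows "A = B \<longleftrightarrow> A$1$1 = B$1$1 \<and> A$1$2 = B$1$2 \<and> A$2$1 = B$2$1 \<and> A$2$2 = B$2$2"
  by (auto simp: vec_eq_iff forall_2)

lemma diag2_in_rank_le_1: "a * b = 0 \<Longrightarrow> diag2 a b \<in> rank_le_1"
  by (simp add: rank_le_1_iff_det)

lemma norm_matrix_2:
  fixes A :: "real^2^2"
  shows "norm A = sqrt ((A$1$1)\<^sup>2 + (A$1$2)\<^sup>2 + (A$2$1)\<^sup>2 + (A$2$2)\<^sup>2)"
  by (simp add: norm_eq_sqrt_inner inner_vec_def sum_2 power2_eq_square)

lemma norm_diag2_0: "norm (diag2 a 0) = \<bar>a\<bar>" "norm (diag2 0 a) = \<bar>a\<bar>"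
  by (simp_all add: norm_matrix_2)

lemma grad_eqI:
  assumes "GDERIV f x :> D"
  shows "grad f x = D"
  unfolding grad_def
proof (rule the_equality)
  fix D' assume "GDERIV f x :> D'"
  hence "(\<lambda>h. h \<bullet> D') = (\<lambda>h. h \<bullet> D)"
    using assms has_derivative_unique unfolding gderiv_def by blast
  thus "D' = D"
    by (metis vector_eq_ldot)
qed (fact assms)

text \<open>Uniqueness is needed twice: to evaluate \<open>the_elem\<close> in
  \<open>stationarity\<close>, and to leave the algorithm no choice.\<close>

lemma proj_eq_singletonI:
  assumes "Y \<in> S" and "\<And>Z. Z \<in> S \<Longrightarrow> Z \<noteq> Y \<Longrightarrow> norm (A - Y) < norm (A - Z)"
  shows "proj S A = {Y}"
  using assms unfolding proj_def is_arg_min_def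
  by (auto dest: less_imp_not_less)

lemma proj_of_mem: "A \<in> S \<Longrightarrow> proj S A = {A}"
  by (rule proj_eq_singletonI) auto

lemma tangent_cone_segmentI:
  assumes "\<And>t. 0 < t \<Longrightarrow> t \<le> 1 \<Longrightarrow> A + t *\<^sub>R V \<in> S"
  shows "V \<in> tangent_cone S A"
  unfolding tangent_cone_def mem_Collect_eq
proof (intro exI conjI allI)
  show "(\<lambda>n. inverse (real (Suc n))) \<longlonglongrightarrow> 0"
    by (rule LIMSEQ_inverse_real_of_nat)
  show "A + inverse (real (Suc i)) *\<^sub>R V \<in> S" for i
    by (rule assms) (auto simp: field_simps)
qed auto

lemma tangent_cone_rank_le_1_diag2:
  assumes "V \<in> tangent_cone rank_le_1 (diag2 x 0)" and "x \<noteq> 0"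
  shows "V$2$2 = 0"
proof -
  obtain t W where tpos: "\<And>i::nat. 0 < t i" and t: "t \<longlonglongrightarrow> (0::real)" and W: "W \<longlonglongrightarrow> V"
    and mem: "\<And>i. diag2 x 0 + t i *\<^sub>R W i \<in> rank_le_1"
    using assms(1) unfolding tangent_cone_def by blast
  have eq: "(x + t i * W i$1$1) * W i$2$2 - t i * (W i$1$2 * W i$2$1) = 0" for i
  proof -
    \<comment> \<open>\<open>det (diag2 x 0)\<close> vanishes, so the determinant of the perturbed
      matrix has the factor \<open>t i\<close>. Once it is cancelled, the limit of the cofactor is
      \<open>x * V$2$2\<close>.\<close>
    have "t i * ((x + t i * W i$1$1) * W i$2$2 - t i * (W i$1$2 * W i$2$1)) = 0"
      using mem[of i] by (simp add: rank_le_1_iff_det algebra_simps)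
    thus ?thesis
      using tpos[of i] by simp
  qed
  have "(\<lambda>i. (x + t i * W i$1$1) * W i$2$2 - t i * (W i$1$2 * W i$2$1))
          \<longlonglongrightarrow> (x + 0 * V$1$1) * V$2$2 - 0 * (V$1$2 * V$2$1)"
    by (intro tendsto_intros t W)
  hence "x * V$2$2 = 0"
    unfolding eq by (simp add: LIMSEQ_const_iff)
  thus ?thesis
    using assms(2) by simp
qed

text \<open>Every tangent \<open>Z\<close> has \<open>Z$2$2 = 0\<close>, so the error
  \<open>b\<close> in that entry is unavoidable; the other three entries can be matched exactly, by
  \<open>diag2 a 0\<close> alone.\<close>

lemma proj_tangent_cone_diag2:
  assumes "x \<noteq> 0"
  shows "proj (tangent_cone rank_le_1 (diag2 x 0)) (diag2 a b) = {diag2 a 0}"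
proof (rule proj_eq_singletonI)
  have "diag2 x 0 + t *\<^sub>R diag2 a 0 = diag2 (x + t * a) 0" for t
    by (simp add: matrix_2_eq_iff)
  thus "diag2 a 0 \<in> tangent_cone rank_le_1 (diag2 x 0)"
    by (intro tangent_cone_segmentI) (simp add: diag2_in_rank_le_1)
next
  fix Z assume "Z \<in> tangent_cone rank_le_1 (diag2 x 0)" and ne: "Z \<noteq> diag2 a 0"
  hence Z: "Z$2$2 = 0"
    using tangent_cone_rank_le_1_diag2 assms by blast
  hence "Z$1$1 \<noteq> a \<or> Z$1$2 \<noteq> 0 \<or> Z$2$1 \<noteq> 0"
    using ne by (auto simp: matrix_2_eq_iff)
  hence "0 < (a - Z$1$1)\<^sup>2 + (Z$1$2)\<^sup>2 + (Z$2$1)\<^sup>2"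
    by (smt (verit) zero_less_power2 zero_le_power2)
  thus "norm (diag2 a b - diag2 a 0) < norm (diag2 a b - Z)"
    by (simp add: norm_matrix_2 Z real_less_rsqrt)
qed

theorem proposition1:
  fixes x0 \<alpha> \<beta> c :: real
    and f :: "real^2^2 \<Rightarrow> real"
    and X :: "nat \<Rightarrow> real^2^2"
  assumes "0 < x0"
    and "0 < \<alpha>" and "\<alpha> < 1"
    and "0 < \<beta>" and "\<beta> < 1"
    and "0 < c" and "c \<le> 1 / 2"
    and f_def: "\<And>A. f A = ((A$1$1)\<^sup>2 + (A$2$2 - 1)\<^sup>2 + (A$1$2 - A$2$1)\<^sup>2) / 2"
    and X_def: "\<And>i. X i = diag2 ((1 - \<alpha>) ^ i * x0) 0"
  shows "p2gd_produces f \<alpha> \<alpha> \<beta> c (diag2 x0 0) X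
    \<and> (\<forall>i. stationarity f (X i) = (1 - \<alpha>) ^ i * x0)
    \<and> stationarity f 0 = norm (grad f 0) \<and> norm (grad f 0) = 1
    \<and> apocalypse 0 X f"
proof -
  have nth: "((\<lambda>A::real^2^2. A$i$j) has_derivative (\<lambda>H. H$i$j)) F" for i j F
    by (intro bounded_linear_imp_has_derivative
          bounded_linear_compose[OF bounded_linear_vec_nth bounded_linear_vec_nth])
  \<comment> \<open>The term \<open>(A$1$2 - A$2$1)\<^sup>2\<close> contributes nothing, its base
    being zero at diagonal matrices.\<close>
  have grad: "grad f (diag2 x 0) = diag2 x (- 1)" for x
    by (intro grad_eqI)
      (auto simp: gderiv_def f_def[abs_def] inner_vec_def sum_2 field_simps
         intro!: derivative_eq_intros nth)
  have diag2_minus: "- diag2 a b = diag2 (- a) (- b)" for a b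
    by (simp add: matrix_2_eq_iff)
  have zero: "(0 :: real^2^2) = diag2 0 0"
    by (simp add: matrix_2_eq_iff)

  have proj: "proj (tangent_cone rank_le_1 (diag2 x 0)) (- grad f (diag2 x 0)) = {diag2 (- x) 0}"
    if "x > 0" for x
    using that by (simp add: grad diag2_minus proj_tangent_cone_diag2)
  hence stat: "stationarity f (diag2 x 0) = x" if "x > 0" for x
    using that by (simp add: stationarity_def norm_diag2_0)

  have step: "p2gd_map f \<alpha> \<alpha> \<beta> c (diag2 x 0) = {diag2 ((1 - \<alpha>) * x) 0}" if "x > 0" for x
  proof -
    let ?Y = "diag2 ((1 - \<alpha>) * x) 0"
    have "diag2 x 0 + \<alpha> *\<^sub>R diag2 (- x) 0 = ?Y"
      by (simp add: matrix_2_eq_iff algebra_simps)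
    hence projY: "proj rank_le_1 (diag2 x 0 + \<alpha> *\<^sub>R diag2 (- x) 0) = {?Y}"
      by (simp add: proj_of_mem diag2_in_rank_le_1)
    have "f (diag2 x 0) - c * \<alpha> * x\<^sup>2 - f ?Y = \<alpha> * x\<^sup>2 * (1 - \<alpha> / 2 - c)"
      by (simp add: f_def field_simps power2_eq_square)
    \<comment> \<open>Here c \<le> 1/2 enters: together with \<alpha> < 1 it bounds \<alpha>/2 + c
      by 1.\<close>
    also have "\<dots> \<ge> 0"
      using assms by simp
    finally have dec: "\<not> f ?Y > f (diag2 x 0) - c * \<alpha> * (stationarity f (diag2 x 0))\<^sup>2"
      using stat[OF that] by simp
    \<comment> \<open>One unfolding of the loop suffices: backtracking would require a projected
      point that fails the decrease test, and the only projected point passes it.\<close>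
    have "p2gd_search f \<beta> c (diag2 x 0) (diag2 (- x) 0) \<alpha> Y \<longleftrightarrow> Y = ?Y" for Y
      using projY dec by (subst p2gd_search.simps) auto
    thus ?thesis
      by (simp add: p2gd_map_def proj[OF that])
  qed

  have pos: "(1 - \<alpha>) ^ i * x0 > 0" for i
    using assms by simp
  have statX: "stationarity f (X i) = (1 - \<alpha>) ^ i * x0" for i
    by (simp add: X_def stat pos)
  have produces: "p2gd_produces f \<alpha> \<alpha> \<beta> c (diag2 x0 0) X"
    unfolding p2gd_produces_def statX
    using pos step[OF pos] by (auto simp: X_def diag2_in_rank_le_1 mult.assoc)

  have "0 + t *\<^sub>R diag2 0 1 = diag2 0 t" for t :: real
    by (simp add: matrix_2_eq_iff)
  hence "diag2 0 1 \<in> tangent_cone rank_le_1 0"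
    by (intro tangent_cone_segmentI) (simp add: diag2_in_rank_le_1)
  moreover have grad0: "grad f 0 = diag2 0 (- 1)"
    by (simp add: zero grad)
  \<comment> \<open>\<open>- grad f 0\<close> is itself tangent at \<open>0\<close>, hence its own
    projection.\<close>
  ultimately have stat0: "stationarity f 0 = 1"
    by (simp add: stationarity_def diag2_minus proj_of_mem norm_diag2_0)

  have lim: "(\<lambda>i. (1 - \<alpha>) ^ i * x0) \<longlonglongrightarrow> 0"
    using assms by (intro tendsto_mult_left_zero LIMSEQ_realpow_zero) auto
  have "X \<longlonglongrightarrow> 0"
  proof (rule tendsto_norm_zero_cancel)
    \<comment> \<open>\<open>norm (X i)\<close> equals \<open>stationarity f (X i)\<close>, so one
      geometric limit gives both convergences of the apocalypse.\<close>
    show "(\<lambda>i. norm (X i)) \<longlonglongrightarrow> 0"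
      using lim pos by (simp add: X_def norm_diag2_0 abs_of_pos)
  qed
  moreover have "(0 :: real^2^2) \<in> rank_le_1"
    by (simp add: zero diag2_in_rank_le_1)
  ultimately have "apocalypse 0 X f"
    unfolding apocalypse_def statX
    using lim by (simp add: stat0 X_def diag2_in_rank_le_1)
  thus ?thesis
    using produces statX stat0 grad0 by (simp add: norm_diag2_0)
qed

end
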